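(* Let $(\mathbf H,\mathbf z,\mathcal G)$ be a network linear equation as in the context, and assume: (A1) $\operatorname{rank}(\mathbf H)=m$ and $\mathbf z\in\operatorname{span}(\mathbf H)$, so that $\mathbf z=\mathbf H\mathbf y$ has a unique solution $\mathbf y^*$; (A2) $\max_i\|\mathbf x_i(0)\|_\infty\le C_x$ and $\max_i\|\mathbf x_i(0)-\mathbf y^*\|_\infty\le C_w$ for some positive constants $C_x,C_w$; (A3) $\gamma(k)\equiv 1$ and $s(k)=s(0)\alpha^k$ for all $k\ge0$, for some $s(0)>0$ and $\alpha\in(0,1)$. Let $h\in\left(0,\frac{2}{\lambda_{\min}(\mathbf F_d)+\lambda_{\max}(\mathbf F_d)}\right)$ and $\alpha\in(1-h\lambda_{\min}(\mathbf F_d),1)$. Then for any integer $K\ge\mathcal K(\alpha,h)$, if $$s(0)>\max\left\{\frac{C_x+h\|\mathbf H_d\|_\infty C_w}{K+\frac12},\ \frac{2(\alpha-\rho_h)\left(\rho_hC_w+hC_x\lambda_N(\mathbf L)\right)}{h\lambda_N(\mathbf L)}\right\},$$ the sequences generated by the distributed quantized algorithm (with parameters $h,K,s(\cdot),\gamma(\cdot)$) satisfy $$\lim_{k\to\infty}\mathbf x_i(k)=\mathbf y^*\quad\text{for all } i\in\mathcal V,$$ and moreover, with $\mathbf x(k)=(\mathbf x_1(k)^\top,\dots,\mathbf x_N(k)^\top)^\top$, $$\limsup_{k\to\infty}\frac{\|\mathbf x(k)-\mathbf 1_N\otimes\mathbf y^*\|_2}{\alpha^k}\le\frac{h\,s(0)\sqrt{mN}\,\lambda_N(\mathbf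 L)}{2\alpha(\alpha-\rho_h)}.$$
   Context: Setting. $N\ge2$, $m\ge1$; $\mathbf H\in\mathbb R^{N\times m}$ has $i$-th row $\mathbf h_i^\top$ ($\mathbf h_i\in\mathbb R^m$), $\mathbf z=(z_1,\dots,z_N)^\top\in\mathbb R^N$; $\operatorname{span}(\mathbf H)$ is the column space. $\mathcal G=(\mathcal V,\mathcal E)$ is a connected undirected simple graph on $\mathcal V=\{1,\dots,N\}$ with neighbor sets $\mathcal N_i$, maximum degree $d^*=\max_i|\mathcal N_i|$, and Laplacian $\mathbf L$ (degree matrix minus adjacency matrix) with eigenvalues $0=\lambda_1(\mathbf L)<\lambda_2(\mathbf L)\le\dots\le\lambda_N(\mathbf L)$. Norms of matrices are the induced ones; $\mathbf 1_N$ is the all-ones vector; $\otimes$ is the Kronecker product. Matrices: $\mathbf H_d=\operatorname{diag}\{\mathbf h_1\mathbf h_1^\top,\dots,\mathbf h_N\mathbf h_N^\top\}\in\mathbb R^{mN\times mN}$ (block diagonal), $\mathbf F_d=\mathbf L\otimes\mathbf I_m+\mathbf H_d$, with smallest/largest eigenvalues $\lambda_{\min}(\mathbf F_d),\lambda_{\max}(\mathbf F_d)$; $\rho_h=1-h\lambda_{\min}(\mathbf F_d)$. Define $$M(\alpha,h)=\frac{1+2hd^*}{2\alpha}+\frac{h^2\sqrt{mN}\,\lambda_N(\mathbf L)\lambda_{\max}(\mathbf F_d)}{2\alpha(\alpha-\rho_h)},\qquad \mathcal K(\alpha,h)=\left\lceil M(\alpha,h)-\tfrac12\right\rceil.$$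 Quantizer: for an integer $K\ge1$, $Q_K:\mathbb R\to\{-K,\dots,K\}$ is $Q_K(z)=0$ if $-\frac12\le z\le\frac12$; $Q_K(z)=i$ if $\frac{2i-1}2<z\le\frac{2i+1}2$, $i=1,\dots,K$; $Q_K(z)=K$ if $z>\frac{2K+1}2$; $Q_K(z)=-Q_K(-z)$ if $z<-\frac12$. It is applied componentwise to vectors. Distributed quantized algorithm: given initial states $\mathbf x_i(0)\in\mathbb R^m$, a step $h>0$, a sequence $\gamma(k)$ and a positive scaling sequence $s(k)$: encoder at node $j$: $\mathbf b_j(0)=0$ and, for $k\ge1$, $\mathbf q_j(k)=Q_K\left(\frac{1}{s(k-1)}(\mathbf x_j(k)-\mathbf b_j(k-1))\right)$, $\mathbf b_j(k)=s(k-1)\mathbf q_j(k)+\mathbf b_j(k-1)$; decoder at node $i\in\mathcal N_j$: $\hat{\mathbf x}_{ij}(0)=0$ and, for $k\ge1$, $\hat{\mathbf x}_{ij}(k)=s(k-1)\mathbf q_j(k)+\hat{\mathbf x}_{ij}(k-1)$; update, $k\ge0$: $\mathbf x_i(k+1)=\mathbf x_i(k)+h\left[\sum_{j\in\mathcal N_i}(\hat{\mathbf x}_{ij}(k)-\mathbf b_i(k))-\gamma(k)(\mathbf h_i\mathbf h_i^\top\mathbf x_i(k)-z_i\mathbf h_i)\right]$. *)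

theory Defs
  imports "HOL-Analysis.Analysis"
begin

section \<open>Matrices and vectors\<close>

definition eigenvalues :: "real^'k^'k \<Rightarrow> real set" where
  "eigenvalues A = {l. \<exists>v. v \<noteq> 0 \<and> A *v v = l *\<^sub>R v}"

text \<open>The extreme eigenvalues are only meant for symmetric matrices, where the set of real
  eigenvalues is finite and nonempty.\<close>

definition lambda_min :: "real^'k^'k \<Rightarrow> real" where
  "lambda_min A = Min (eigenvalues A)"

definition lambda_max :: "real^'k^'k \<Rightarrow> real" where
  "lambda_max A = Max (eigenvalues A)"

text \<open>The matrix norm induced by the maximum norm (the vector 0 contributes 0 / 0 = 0).\<close>

definition onorm_inf :: "real^'k^'k \<Rightarrow> real" where
  "onorm_inf A = (SUP v. infnorm (A *v v) / infnorm v)"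

text \<open>Vectors and matrices of size m N are indexed by pairs (node, coordinate); the Euclidean
  and maximum norms and the eigenvalues do not depend on the order of the indices.\<close>

definition kron :: "real^'n^'n \<Rightarrow> real^'m^'m \<Rightarrow> real^('n \<times> 'm)^('n \<times> 'm)" where
  "kron A B = (\<chi> p q. A $ fst p $ fst q * B $ snd p $ snd q)"

definition kron_vec :: "real^'n \<Rightarrow> real^'m \<Rightarrow> real^('n \<times> 'm)" where
  "kron_vec u v = (\<chi> p. u $ fst p * v $ snd p)"

definition stack :: "('n::finite \<Rightarrow> real^'m) \<Rightarrow> real^('n \<times> 'm)" where
  "stack x = (\<chi> p. x (fst p) $ snd p)"

definition block_diag :: "('n::finite \<Rightarrow> real^'m^'m) \<Rightarrow> real^('n \<times> 'm)^('n \<times> 'm)" where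
  "block_diag B = (\<chi> p q. if fst p = fst q then B (fst p) $ snd p $ snd q else 0)"

definition outer :: "real^'m \<Rightarrow> real^'m \<Rightarrow> real^'m^'m" where
  "outer u v = (\<chi> a b. u $ a * v $ b)"


section \<open>Graphs\<close>

text \<open>The node set is the whole finite type; an undirected edge is represented by both of its
  orientations.\<close>

definition connected_simple_graph :: "('n \<times> 'n) set \<Rightarrow> bool" where
  "connected_simple_graph E \<longleftrightarrow> sym E \<and> irrefl E \<and> (\<forall>i j. (i, j) \<in> E\<^sup>*)"

definition neighbors :: "('n \<times> 'n) set \<Rightarrow> 'n \<Rightarrow> 'n set" where
  "neighbors E i = {j. (i, j) \<in> E}"

definition max_degree :: "('n::finite \<times> 'n) set \<Rightarrow> nat" where
  "max_degree E = (MAX i. card (neighbors E i))"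

definition laplacian :: "('n::finite \<times> 'n) set \<Rightarrow> real^'n^'n" where
  "laplacian E = (\<chi> i j. (if i = j then real (card (neighbors E i)) else 0)
                        - (if j \<in> neighbors E i then 1 else 0))"


section \<open>The network linear equation\<close>

definition Hd :: "real^'m^'n \<Rightarrow> real^('n \<times> 'm)^('n \<times> 'm)" where
  "Hd H = block_diag (\<lambda>i. outer (H $ i) (H $ i))"

definition Fd :: "real^'m^'n \<Rightarrow> ('n::finite \<times> 'n) set \<Rightarrow> real^('n \<times> 'm)^('n \<times> 'm)" where
  "Fd H E = kron (laplacian E) (mat 1) + Hd H"

definition rho :: "real^'m^'n \<Rightarrow> ('n::finite \<times> 'n) set \<Rightarrow> real \<Rightarrow> real" where
  "rho H E h = 1 - h * lambda_min (Fd H E)"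

definition M_bound :: "real^'m^'n \<Rightarrow> ('n::finite \<times> 'n) set \<Rightarrow> real \<Rightarrow> real \<Rightarrow> real" where
  "M_bound H E \<alpha> h =
     (1 + 2 * h * real (max_degree E)) / (2 * \<alpha>)
     + (h^2 * sqrt (real (CARD('m) * CARD('n))) * lambda_max (laplacian E) * lambda_max (Fd H E))
       / (2 * \<alpha> * (\<alpha> - rho H E h))"

definition K_bound :: "real^'m^'n \<Rightarrow> ('n::finite \<times> 'n) set \<Rightarrow> real \<Rightarrow> real \<Rightarrow> int" where
  "K_bound H E \<alpha> h = \<lceil>M_bound H E \<alpha> h - 1/2\<rceil>"


section \<open>The quantized algorithm\<close>

function quantizer :: "int \<Rightarrow> real \<Rightarrow> int" where
  "quantizer K r =
     (if r < - 1/2 then - quantizer K (- r)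
      else if r \<le> 1/2 then 0
      else if r > (2 * K + 1) / 2 then K
      else (THE i. i \<in> {1..K} \<and> (2 * i - 1) / 2 < r \<and> r \<le> (2 * i + 1) / 2))"
  by auto
termination
  by (relation "Wellfounded.measure (\<lambda>(K :: int, r :: real). if r < - 1/2 then 1 else 0)") auto

declare quantizer.simps [simp del]

definition quantizer_vec :: "int \<Rightarrow> real^'m \<Rightarrow> real^'m" where
  "quantizer_vec K v = (\<chi> a. real_of_int (quantizer K (v $ a)))"

text \<open>The sequences x, b, q, xh are generated from the initial states x0. Here xh k i j is the
  estimate of the state of j decoded at its neighbor i; values of xh for other pairs, and of
  q at time 0, play no role and are unconstrained.\<close>

definition quantized_algorithm ::
  "real^'m^'n \<Rightarrow> real^'n \<Rightarrow> ('n::finite \<times> 'n) set \<Rightarrow> real \<Rightarrow> int \<Rightarrow> (nat \<Rightarrow> real) \<Rightarrow> (nat \<Rightarrow> real) \<Rightarrow>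
   ('n \<Rightarrow> real^'m) \<Rightarrow> (nat \<Rightarrow> 'n \<Rightarrow> real^'m) \<Rightarrow> (nat \<Rightarrow> 'n \<Rightarrow> real^'m) \<Rightarrow> (nat \<Rightarrow> 'n \<Rightarrow> real^'m) \<Rightarrow>
   (nat \<Rightarrow> 'n \<Rightarrow> 'n \<Rightarrow> real^'m) \<Rightarrow> bool" where
  "quantized_algorithm H z E h K \<gamma> s x0 x b q xh \<longleftrightarrow>
     (\<forall>i. x 0 i = x0 i) \<and>
     (\<forall>j. b 0 j = 0) \<and>
     (\<forall>k\<ge>1. \<forall>j. q k j = quantizer_vec K ((1 / s (k - 1)) *\<^sub>R (x k j - b (k - 1) j))) \<and>
     (\<forall>k\<ge>1. \<forall>j. b k j = s (k - 1) *\<^sub>R q k j + b (k - 1) j) \<and>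
     (\<forall>j. \<forall>i\<in>neighbors E j. xh 0 i j = 0) \<and>
     (\<forall>k\<ge>1. \<forall>j. \<forall>i\<in>neighbors E j. xh k i j = s (k - 1) *\<^sub>R q k j + xh (k - 1) i j) \<and>
     (\<forall>k i. x (k + 1) i = x k i + h *\<^sub>R ((\<Sum>j\<in>neighbors E i. xh k i j - b k i)
        - \<gamma> k *\<^sub>R (outer (H $ i) (H $ i) *v x k i - z $ i *\<^sub>R H $ i)))"

lemma quantized_algorithm_exists:
  fixes H :: "real^'m^'n"
  shows "\<exists>x b q xh. quantized_algorithm H z E h K \<gamma> s x0 x b q xh"
proof -
  define Q where "Q k x b = (\<lambda>j. quantizer_vec K ((1 / s k) *\<^sub>R (x j - b j)))"
    for k and x b :: "'n \<Rightarrow> real^'m"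
  define X where "X k x b = (\<lambda>i. x i + h *\<^sub>R ((\<Sum>j\<in>neighbors E i. b j - b i)
        - \<gamma> k *\<^sub>R (outer (H $ i) (H $ i) *v x i - z $ i *\<^sub>R H $ i)))" for k and x b :: "'n \<Rightarrow> real^'m"
  define S where "S = rec_nat (x0, \<lambda>_. 0)
     (\<lambda>k (x, b). (X k x b, \<lambda>j. s k *\<^sub>R Q k (X k x b) b j + b j))"
  have S: "S 0 = (x0, \<lambda>_. 0)"
    "S (Suc k) = (X k (fst (S k)) (snd (S k)),
       \<lambda>j. s k *\<^sub>R Q k (X k (fst (S k)) (snd (S k))) (snd (S k)) j + snd (S k) j)" for k
    by (simp_all add: S_def split: prod.split)
  have "quantized_algorithm H z E h K \<gamma> s x0 (\<lambda>k. fst (S k)) (\<lambda>k. snd (S k))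
     (\<lambda>k. Q (k - 1) (fst (S k)) (snd (S (k - 1)))) (\<lambda>k i j. snd (S k) j)"
    unfolding quantized_algorithm_def
    by (auto simp: S Q_def X_def dest!: Suc_le_D)
  then show ?thesis by blast
qed

end

theory Submission
  imports Defs
begin

text \<open>
  Write \<open>w(k) = x(k) - 1 \<otimes> y*\<close> and \<open>e(k) = x(k) - b(k)\<close>. All decoders of a node reproduce its
  encoder state, so \<open>w(k+1) = (I - h F) w(k) + h (L \<otimes> I) e(k)\<close>, and the vector fed to the
  quantizer is \<open>x(k+1) - b(k) = (I + h (L \<otimes> I)) e(k) - h F w(k)\<close>, to be compared with
  \<open>s(k) (K + 1/2)\<close>. By simultaneous induction, \<open>\<parallel>w(k+1)\<parallel> \<le> c s(k)\<close> with
  \<open>c = h sqrt(m N) \<lambda>\<^sub>N(L) / (2 (\<alpha> - \<rho>))\<close>, and the quantizer never saturates, so that the maximum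
  norm of \<open>e(k+1)\<close> is at most \<open>s(k)/2\<close>: the constant \<open>c\<close> is the fixed point of
  \<open>\<alpha> c = \<rho> c + h sqrt(m N) \<lambda>\<^sub>N(L) / 2\<close>, and the bound on \<open>K\<close> says exactly that these estimates
  keep the quantizer input in range.

  The spectral norm bounds only need that a symmetric matrix has an eigenvalue whose modulus is
  its norm.
\<close>

section \<open>Symmetric matrices\<close>

lemma inner_symmetric_matrix:
  fixes A :: "real^'k^'k"
  assumes "transpose A = A"
  shows "(A *v x) \<bullet> y = x \<bullet> (A *v y)"
  by (metis assms dot_lmul_matrix transpose_matrix_vector)

text \<open>A maximiser \<open>v\<close> of \<open>norm (A *v v)\<close> on the unit sphere, with
  maximum \<open>\<sigma>\<close>, is an eigenvector of the square of \<open>A\<close>: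
  \<open>\<sigma>\<^sup>2\<close> is both the inner product of \<open>A *v (A *v v)\<close> with
  \<open>v\<close> and an upper bound for its norm, so equality holds in Cauchy-Schwarz. No spectral
  theorem is involved.\<close>

lemma symmetric_matrix_norm_eigenvalue:
  fixes A :: "real^'k^'k"
  assumes sym: "transpose A = A"
  obtains l where "l \<in> eigenvalues A" "\<And>x. norm (A *v x) \<le> \<bar>l\<bar> * norm x"
proof -
  have "compact (sphere (0::real^'k) 1)" "sphere (0::real^'k) 1 \<noteq> {}"
    by auto
  moreover have "continuous_on (sphere 0 1) (\<lambda>x. norm (A *v x))"
    by (intro continuous_intros matrix_vector_mult_linear_continuous_on)
  ultimately obtain v where v: "norm v = 1"
    and max: "\<And>y. norm y = 1 \<Longrightarrow> norm (A *v y) \<le> norm (A *v v)"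
    using continuous_attains_sup[of "sphere (0::real^'k) 1" "\<lambda>x. norm (A *v x)"] by auto
  define \<sigma> where "\<sigma> = norm (A *v v)"
  have bound: "norm (A *v x) \<le> \<sigma> * norm x" for x
  proof (cases "x = 0")
    case False
    have "norm (A *v (inverse (norm x) *\<^sub>R x)) \<le> \<sigma>"
      unfolding \<sigma>_def by (rule max) (use False in simp)
    then show ?thesis
      using False by (simp add: matrix_vector_mult_scaleR field_simps)
  qed simp
  have "norm (A *v (A *v v)) \<le> \<sigma>\<^sup>2"
    using bound[of "A *v v"] by (simp add: \<sigma>_def power2_eq_square)
  then have "(norm (A *v (A *v v)))\<^sup>2 \<le> (\<sigma>\<^sup>2)\<^sup>2"
    by (intro power_mono) auto
  moreover have "(A *v (A *v v)) \<bullet> v = \<sigma>\<^sup>2"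
    by (simp add: inner_symmetric_matrix[OF sym] \<sigma>_def power2_norm_eq_inner)
  moreover have "(norm (A *v (A *v v) - \<sigma>\<^sup>2 *\<^sub>R v))\<^sup>2
      = (norm (A *v (A *v v)))\<^sup>2 - 2 * \<sigma>\<^sup>2 * ((A *v (A *v v)) \<bullet> v) + (\<sigma>\<^sup>2)\<^sup>2 * (norm v)\<^sup>2"
    unfolding power2_norm_eq_inner
    by (simp add: inner_diff_left inner_diff_right inner_commute algebra_simps power2_eq_square)
  ultimately have "(norm (A *v (A *v v) - \<sigma>\<^sup>2 *\<^sub>R v))\<^sup>2 \<le> 0"
    by (simp add: v power2_eq_square)
  then have AA: "A *v (A *v v) = \<sigma>\<^sup>2 *\<^sub>R v"
    by simp
  \<comment> \<open>Now \<open>(A - \<sigma>) (A + \<sigma>) v = 0\<close>, so either \<open>v\<close> or \<open>(A + \<sigma>) v\<close> is an eigenvector.\<close>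
  define u where "u = A *v v + \<sigma> *\<^sub>R v"
  have "\<exists>l \<in> eigenvalues A. \<bar>l\<bar> = \<sigma>"
  proof (cases "u = 0")
    case True
    then have "A *v v = (- \<sigma>) *\<^sub>R v"
      by (simp add: u_def eq_neg_iff_add_eq_0)
    moreover have "v \<noteq> 0"
      using v by auto
    ultimately have "- \<sigma> \<in> eigenvalues A"
      unfolding eigenvalues_def by blast
    then show ?thesis
      by (rule bexI[rotated]) (simp add: \<sigma>_def)
  next
    case False
    have "A *v u = \<sigma> *\<^sub>R u"
      by (simp add: u_def matrix_vector_right_distrib matrix_vector_mult_scaleR AA
          scaleR_add_right power2_eq_square)
    then show ?thesis
      using False by (intro bexI[of _ \<sigma>]) (auto simp: eigenvalues_def \<sigma>_def)
  qed
  then show ?thesis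
    using that bound by metis
qed

text \<open>Eigenvectors for distinct eigenvalues are orthogonal, and a pairwise orthogonal set in
  finite dimension is finite. This gives \<open>Min\<close> and \<open>Max\<close> in
  \<open>lambda_min\<close> and \<open>lambda_max\<close> their meaning.\<close>

lemma finite_eigenvalues_symmetric:
  fixes A :: "real^'k^'k"
  assumes sym: "transpose A = A"
  shows "finite (eigenvalues A)"
proof -
  define f where "f l = (SOME v. v \<noteq> 0 \<and> A *v v = l *\<^sub>R v)" for l
  have f: "f l \<noteq> 0" "A *v f l = l *\<^sub>R f l" if "l \<in> eigenvalues A" for l
    using that someI_ex[of "\<lambda>v. v \<noteq> 0 \<and> A *v v = l *\<^sub>R v"]
    by (auto simp: eigenvalues_def f_def)
  have orth: "f l \<bullet> f r = 0" if "l \<in> eigenvalues A" "r \<in> eigenvalues A" "l \<noteq> r" for l r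
    using inner_symmetric_matrix[OF sym, of "f l" "f r"] f that by auto
  have "inj_on f (eigenvalues A)"
    by (rule inj_onI) (metis f(1) inner_eq_zero_iff orth)
  moreover have "pairwise orthogonal (f ` eigenvalues A)"
    using orth by (auto simp: pairwise_def orthogonal_def)
  then have "finite (f ` eigenvalues A)"
    by (rule pairwise_orthogonal_imp_finite)
  ultimately show ?thesis
    using finite_imageD by blast
qed

lemma eigenvalue_bounds:
  fixes A :: "real^'k^'k"
  assumes "transpose A = A" "l \<in> eigenvalues A"
  shows "lambda_min A \<le> l" "l \<le> lambda_max A"
  using assms finite_eigenvalues_symmetric[of A]
  by (auto simp: lambda_min_def lambda_max_def)


section \<open>The maximum norm\<close>

lemma infnorm_le_cart:
  fixes v :: "real^'k"
  assumes "\<And>i. \<bar>v $ i\<bar> \<le> c"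
  shows "infnorm v \<le> c"
  unfolding infnorm_cart using assms by (auto intro!: cSup_least)

lemma norm_le_infnorm_cart:
  fixes v :: "real^'k"
  shows "norm v \<le> sqrt (real CARD('k)) * infnorm v"
  using norm_le_infnorm[of v] by simp

lemma infnorm_diff_scaleR_le:
  fixes u v :: "'a::euclidean_space"
  assumes "0 \<le> c"
  shows "infnorm (u - c *\<^sub>R v) \<le> infnorm u + c * infnorm v"
  using infnorm_triangle[of u "- (c *\<^sub>R v)"] assms
  by (simp add: infnorm_neg infnorm_mul)

text \<open>The supremum defining \<open>onorm_inf\<close> bounds its members only once the ratios
  are known to be bounded above; this follows from boundedness of \<open>A\<close> in the Euclidean
  norm and equivalence of the two norms.\<close>

lemma infnorm_ratio_le_onorm_inf:
  fixes A :: "real^'k^'k"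
  shows "infnorm (A *v v) / infnorm v \<le> onorm_inf A"
proof -
  obtain B where B: "\<And>v. norm (A *v v) \<le> norm v * B" "B > 0"
    using bounded_linear.pos_bounded[OF matrix_vector_mul_bounded_linear[of A]] by blast
  have "infnorm (A *v w) / infnorm w \<le> B * sqrt (real CARD('k))" for w
  proof (cases "w = 0")
    case nz: False
    have "infnorm (A *v w) \<le> norm w * B"
      using infnorm_le_norm B order_trans by blast
    also have "\<dots> \<le> (sqrt (real CARD('k)) * infnorm w) * B"
      using B norm_le_infnorm_cart by (intro mult_right_mono) auto
    finally show ?thesis
      using nz by (simp add: divide_le_eq infnorm_pos_lt mult_ac)
  qed (use B in \<open>auto simp: infnorm_0\<close>)
  then have "bdd_above (range (\<lambda>w. infnorm (A *v w) / infnorm w))"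
    by (auto intro!: bdd_aboveI)
  then show ?thesis
    unfolding onorm_inf_def by (intro cSUP_upper) auto
qed

lemma onorm_inf_nonneg: "0 \<le> onorm_inf A"
  using infnorm_ratio_le_onorm_inf[of A 0] by (simp add: infnorm_0)

lemma infnorm_mult_le_onorm_inf:
  fixes A :: "real^'k^'k"
  shows "infnorm (A *v v) \<le> onorm_inf A * infnorm v"
proof (cases "v = 0")
  case False
  then show ?thesis
    using infnorm_ratio_le_onorm_inf[of A v] by (simp add: divide_le_eq infnorm_pos_lt)
qed (simp add: infnorm_0)


section \<open>Laplacian and block structure\<close>

lemma laplacian_mult_component:
  "(laplacian E *v v) $ i = (\<Sum>j\<in>neighbors E i. v $ i - v $ j)"
proof -
  have "(laplacian E *v v) $ i
      = (\<Sum>j\<in>UNIV. (if i = j then real (card (neighbors E i)) * v $ j else 0)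
          - (if j \<in> neighbors E i then v $ j else 0))"
    unfolding matrix_vector_mult_def laplacian_def
    by (auto intro!: sum.cong simp: algebra_simps)
  also have "\<dots> = real (card (neighbors E i)) * v $ i - (\<Sum>j\<in>neighbors E i. v $ j)"
    by (simp add: sum_subtractf sum.If_cases)
  finally show ?thesis
    by (simp add: sum_subtractf)
qed

lemma kron_mat_1_mult_component:
  fixes A :: "real^'n^'n" and v :: "real^('n::finite \<times> 'm::finite)"
  shows "(kron A (mat 1) *v v) $ (i, a) = (A *v (\<chi> j. v $ (j, a))) $ i"
proof -
  have "(kron A (mat 1) *v v) $ (i, a)
      = (\<Sum>j\<in>UNIV. \<Sum>c\<in>UNIV. if a = c then A $ i $ j * v $ (j, c) else 0)"
    unfolding matrix_vector_mult_def kron_def mat_def UNIV_Times_UNIV[symmetric]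
      sum.cartesian_product
    by (auto intro!: sum.cong)
  then show ?thesis
    by (simp add: matrix_vector_mult_def)
qed

lemma block_diag_mult_component:
  fixes v :: "real^('n::finite \<times> 'm::finite)"
  shows "(block_diag B *v v) $ (i, a) = (B i *v (\<chi> c. v $ (i, c))) $ a"
proof -
  have "(block_diag B *v v) $ (i, a)
      = (\<Sum>j\<in>UNIV. \<Sum>c\<in>UNIV. (if i = j then B i $ a $ c * v $ (j, c) else 0))"
    unfolding matrix_vector_mult_def block_diag_def UNIV_Times_UNIV[symmetric]
      sum.cartesian_product
    by (auto intro!: sum.cong)
  also have "\<dots> = (\<Sum>c\<in>UNIV. \<Sum>j\<in>UNIV. (if i = j then B i $ a $ c * v $ (j, c) else 0))"
    by (rule sum.swap)
  finally show ?thesis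
    by (simp add: matrix_vector_mult_def)
qed

lemma transpose_laplacian:
  assumes "sym E"
  shows "transpose (laplacian E) = laplacian E"
  using symD[OF assms]
  by (auto simp: transpose_def laplacian_def neighbors_def vec_eq_iff)

lemma transpose_kron_mat_1:
  assumes "transpose A = A"
  shows "transpose (kron A (mat 1)) = kron A (mat 1)"
proof -
  have "A $ j $ i = A $ i $ j" for i j
    using assms by (metis transpose_def vec_lambda_beta)
  then show ?thesis
    by (auto simp: transpose_def kron_def mat_def vec_eq_iff)
qed

lemma transpose_Fd:
  assumes "sym E"
  shows "transpose (Fd H E) = Fd H E"
proof -
  have "transpose (Hd H) = Hd H"
    by (auto simp: transpose_def Hd_def block_diag_def outer_def vec_eq_iff)
  then show ?thesis
    using transpose_kron_mat_1[OF transpose_laplacian[OF assms]]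
    by (simp add: Fd_def transpose_def vec_eq_iff)
qed

text \<open>Adding the quadratic form to its copy with \<open>i\<close> and \<open>j\<close>
  exchanged turns it into a sum of squares \<open>(v $ i - v $ j)\<^sup>2\<close> over the oriented
  edges.\<close>

lemma laplacian_eigenvalue_nonneg:
  assumes "sym E" "l \<in> eigenvalues (laplacian E)"
  shows "0 \<le> l"
proof -
  obtain v where v: "v \<noteq> 0" "laplacian E *v v = l *\<^sub>R v"
    using assms by (auto simp: eigenvalues_def)
  define f where "f i j = (if (i, j) \<in> E then v $ i * (v $ i - v $ j) else 0)" for i j
  have "l * (v \<bullet> v) = v \<bullet> (laplacian E *v v)"
    by (simp add: v)
  also have "\<dots> = (\<Sum>i\<in>UNIV. \<Sum>j\<in>UNIV. f i j)"
    by (simp add: inner_vec_def laplacian_mult_component neighbors_def f_def sum.If_cases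
        sum_distrib_left)
  finally have 1: "l * (v \<bullet> v) = (\<Sum>i\<in>UNIV. \<Sum>j\<in>UNIV. f i j)" .
  also have "\<dots> = (\<Sum>i\<in>UNIV. \<Sum>j\<in>UNIV. f j i)"
    by (rule sum.swap)
  finally have "2 * (l * (v \<bullet> v)) = (\<Sum>i\<in>UNIV. \<Sum>j\<in>UNIV. f i j + f j i)"
    using 1 by (simp add: sum.distrib)
  moreover have "f i j + f j i = (if (i, j) \<in> E then (v $ i - v $ j)\<^sup>2 else 0)" for i j
    using symD[OF assms(1)] by (auto simp: f_def algebra_simps power2_eq_square)
  ultimately have "0 \<le> 2 * (l * (v \<bullet> v))"
    by (auto intro!: sum_nonneg)
  moreover have "v \<bullet> v > 0"
    using v by simp
  ultimately show ?thesis
    by (simp add: zero_le_mult_iff)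
qed

text \<open>The matrix acts on each coordinate slice separately, so any nonzero slice of an
  eigenvector is an eigenvector of \<open>A\<close>.\<close>

lemma eigenvalues_kron_mat_1:
  "eigenvalues (kron A (mat 1)) \<subseteq> eigenvalues A"
proof
  fix l assume "l \<in> eigenvalues (kron A (mat 1 :: real^'b^'b))"
  then obtain v where v: "v \<noteq> 0" "kron A (mat 1 :: real^'b^'b) *v v = l *\<^sub>R v"
    by (auto simp: eigenvalues_def)
  then obtain i a where "v $ (i, a) \<noteq> 0"
    by (metis surj_pair vec_eq_iff zero_index)
  then have "(\<chi> j. v $ (j, a)) \<noteq> 0"
    by (auto simp: vec_eq_iff)
  moreover have "A *v (\<chi> j. v $ (j, a)) = l *\<^sub>R (\<chi> j. v $ (j, a))"
    using kron_mat_1_mult_component[of A v _ a] by (simp add: v vec_eq_iff)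
  ultimately show "l \<in> eigenvalues A"
    by (auto simp: eigenvalues_def)
qed

lemma norm_kron_laplacian_le:
  fixes v :: "real^('n::finite \<times> 'm::finite)"
  assumes "sym E"
  shows "norm (kron (laplacian E) (mat 1) *v v) \<le> lambda_max (laplacian E) * norm v"
proof -
  obtain l where l: "l \<in> eigenvalues (kron (laplacian E) (mat 1 :: real^'m^'m))"
    "norm (kron (laplacian E) (mat 1) *v v) \<le> \<bar>l\<bar> * norm v"
    using symmetric_matrix_norm_eigenvalue
      [OF transpose_kron_mat_1[OF transpose_laplacian[OF assms]]] by metis
  then have "l \<in> eigenvalues (laplacian E)"
    using eigenvalues_kron_mat_1 by blast
  then have "\<bar>l\<bar> \<le> lambda_max (laplacian E)"
    using eigenvalue_bounds(2)[OF transpose_laplacian] laplacian_eigenvalue_nonneg assms by force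
  then show ?thesis
    using l(2) by (meson mult_right_mono norm_ge_zero order_trans)
qed

text \<open>Two distinct nodes and connectedness yield an edge, so the Laplacian is not zero and its
  norm-attaining eigenvalue is nonzero, hence positive. Positivity permits clearing the denominator
  in the second bound on \<open>s 0\<close>.\<close>

lemma lambda_max_laplacian_pos:
  fixes E :: "('n::finite \<times> 'n) set"
  assumes "connected_simple_graph E" "CARD('n) \<ge> 2"
  shows "0 < lambda_max (laplacian E)"
proof -
  have E: "sym E" "irrefl E" "\<And>i j. (i, j) \<in> E\<^sup>*"
    using assms by (auto simp: connected_simple_graph_def)
  have "\<not> CARD('n) \<le> 1"
    using assms by simp
  then obtain i j :: 'n where "i \<noteq> j"
    by (auto simp: card_le_Suc0_iff_eq)
  then obtain k where k: "(i, k) \<in> E"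
    using E(3)[of i j] by (auto elim: converse_rtranclE)
  with E have "k \<noteq> i"
    by (auto simp: irrefl_def)
  have "(laplacian E *v axis i 1) $ k \<noteq> 0"
    using k \<open>k \<noteq> i\<close> symD[OF E(1) k]
    by (simp add: matrix_vector_mult_basis column_def laplacian_def neighbors_def)
  then have nz: "laplacian E *v axis i 1 \<noteq> 0"
    by (metis zero_index)
  obtain l where l: "l \<in> eigenvalues (laplacian E)"
    "\<And>x. norm (laplacian E *v x) \<le> \<bar>l\<bar> * norm x"
    using symmetric_matrix_norm_eigenvalue[OF transpose_laplacian[OF E(1)]] by metis
  have "l \<noteq> 0"
    using l(2)[of "axis i 1"] nz by auto
  then show ?thesis
    using laplacian_eigenvalue_nonneg[OF E(1) l(1)]
      eigenvalue_bounds(2)[OF transpose_laplacian[OF E(1)] l(1)] by linarith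
qed

text \<open>Row \<open>i\<close> of the Laplacian sums differences over the neighbors of
  \<open>i\<close>, each at most twice the maximum norm. This is the origin of the first summand of
  \<open>M_bound\<close>.\<close>

lemma infnorm_add_kron_laplacian_le:
  fixes v :: "real^('n::finite \<times> 'm::finite)"
  assumes "0 \<le> h"
  shows "infnorm (v + h *\<^sub>R (kron (laplacian E) (mat 1) *v v))
    \<le> (1 + 2 * h * real (max_degree E)) * infnorm v"
proof (rule infnorm_le_cart)
  fix p :: "'n \<times> 'm"
  obtain i a where p: "p = (i, a)" by (cases p)
  have v: "\<bar>v $ r\<bar> \<le> infnorm v" for r
    by (rule component_le_infnorm_cart)
  have "\<bar>\<Sum>j\<in>neighbors E i. v $ (i, a) - v $ (j, a)\<bar> \<le> (\<Sum>j\<in>neighbors E i. 2 * infnorm v)"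
  proof (intro sum_abs[THEN order_trans] sum_mono)
    fix j
    show "\<bar>v $ (i, a) - v $ (j, a)\<bar> \<le> 2 * infnorm v"
      using v[of "(i, a)"] v[of "(j, a)"] by linarith
  qed
  also have "\<dots> = real (card (neighbors E i)) * (2 * infnorm v)"
    by simp
  also have "\<dots> \<le> real (max_degree E) * (2 * infnorm v)"
    unfolding max_degree_def
    by (intro mult_right_mono) (auto simp: infnorm_pos_le)
  finally have "h * \<bar>\<Sum>j\<in>neighbors E i. v $ (i, a) - v $ (j, a)\<bar>
      \<le> h * (real (max_degree E) * (2 * infnorm v))"
    using assms by (intro mult_left_mono) auto
  then show "\<bar>(v + h *\<^sub>R (kron (laplacian E) (mat 1) *v v)) $ p\<bar>
    \<le> (1 + 2 * h * real (max_degree E)) * infnorm v"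
    using v[of "(i, a)"] assms abs_triangle_ineq[of "v $ (i, a)"
      "h * (\<Sum>j\<in>neighbors E i. v $ (i, a) - v $ (j, a))"]
    by (simp add: p kron_mat_1_mult_component laplacian_mult_component abs_mult algebra_simps)
qed


section \<open>Spectral bounds for the error dynamics\<close>

lemma lambda_min_le_lambda_max:
  fixes A :: "real^'k^'k"
  assumes "transpose A = A"
  shows "lambda_min A \<le> lambda_max A"
  using symmetric_matrix_norm_eigenvalue[OF assms] eigenvalue_bounds[OF assms] order_trans by metis

text \<open>The sign condition says that \<open>lambda_max A\<close> dominates
  \<open>- lambda_min A\<close>, so it bounds the modulus of every eigenvalue.\<close>

lemma norm_symmetric_matrix_le:
  fixes A :: "real^'k^'k"
  assumes "transpose A = A" "0 \<le> lambda_min A + lambda_max A"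
  shows "norm (A *v v) \<le> lambda_max A * norm v"
proof -
  obtain l where l: "l \<in> eigenvalues A" "norm (A *v v) \<le> \<bar>l\<bar> * norm v"
    using symmetric_matrix_norm_eigenvalue[OF assms(1)] by metis
  then have "\<bar>l\<bar> \<le> lambda_max A"
    using eigenvalue_bounds[OF assms(1) l(1)] assms(2) by linarith
  then show ?thesis
    using l(2) by (meson mult_right_mono norm_ge_zero order_trans)
qed

text \<open>The eigenvalues of \<open>mat 1 - h *\<^sub>R A\<close> are 1 - h \<mu> for eigenvalues
  \<mu> of \<open>A\<close>. The upper bound on \<open>h\<close> makes the end at
  \<open>lambda_min A\<close> the larger one in modulus.\<close>

lemma norm_diff_symmetric_matrix_le:
  fixes A :: "real^'k^'k"
  assumes sym: "transpose A = A" and h: "0 < h" "h * (lambda_min A + lambda_max A) \<le> 2"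
  shows "norm (v - h *\<^sub>R (A *v v)) \<le> (1 - h * lambda_min A) * norm v"
proof -
  let ?B = "mat 1 - h *\<^sub>R A"
  have B: "?B *v u = u - h *\<^sub>R (A *v u)" for u
    by (simp add: matrix_vector_mult_diff_rdistrib scaleR_matrix_vector_assoc)
  have "transpose ?B = ?B"
    using sym by (auto simp: transpose_def mat_def vec_eq_iff)
  then obtain l where l: "l \<in> eigenvalues ?B" "norm (?B *v v) \<le> \<bar>l\<bar> * norm v"
    using symmetric_matrix_norm_eigenvalue by metis
  then obtain u where u: "u \<noteq> 0" "u - h *\<^sub>R (A *v u) = l *\<^sub>R u"
    by (auto simp: eigenvalues_def B)
  then have "h *\<^sub>R (A *v u) = (1 - l) *\<^sub>R u"
    by (simp add: algebra_simps)
  then have "A *v u = ((1 - l) / h) *\<^sub>R u"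
    using h by (metis divideR_right divide_inverse_commute order_less_irrefl scaleR_scaleR)
  then have "(1 - l) / h \<in> eigenvalues A"
    using u by (auto simp: eigenvalues_def)
  from eigenvalue_bounds[OF sym this] have "lambda_min A * h \<le> 1 - l" "1 - l \<le> lambda_max A * h"
    using h by (auto simp: pos_le_divide_eq pos_divide_le_eq)
  then have "\<bar>l\<bar> \<le> 1 - h * lambda_min A"
    using h(2) by (simp add: algebra_simps abs_le_iff)
  then show ?thesis
    using l(2) by (metis B mult_right_mono norm_ge_zero order_trans)
qed


section \<open>The quantized algorithm\<close>

lemma quantizer_error:
  assumes "0 \<le> K" "\<bar>r\<bar> \<le> real_of_int K + 1 / 2"
  shows "\<bar>r - real_of_int (quantizer K r)\<bar> \<le> 1 / 2"
proof -
  have pos: "\<bar>t - real_of_int (quantizer K t)\<bar> \<le> 1 / 2"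
    if t: "- 1 / 2 \<le> t" "t \<le> real_of_int K + 1 / 2" for t
  proof (cases "t \<le> 1 / 2")
    case True
    then show ?thesis
      using t by (subst quantizer.simps) auto
  next
    case False
    let ?P = "\<lambda>i. i \<in> {1..K} \<and> real_of_int (2 * i - 1) / 2 < t \<and> t \<le> real_of_int (2 * i + 1) / 2"
    \<comment> \<open>The cells are closed on the right, so rounding is the ceiling of
      \<open>t - 1 / 2\<close>; non-saturation keeps it at most \<open>K\<close>.\<close>
    have c: "?P \<lceil>t - 1 / 2\<rceil>"
      using False t by (auto simp: ceiling_le_iff le_ceiling_iff) linarith+
    have u: "i = j" if "?P i" "?P j" for i j
    proof -
      have "real_of_int (2 * i - 1) < real_of_int (2 * j + 1)"
        "real_of_int (2 * j - 1) < real_of_int (2 * i + 1)"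
        using that(1)[THEN conjunct2] that(2)[THEN conjunct2]
        by (auto simp: field_simps)
      then show ?thesis
        unfolding of_int_less_iff by linarith
    qed
    have "?P (THE i. ?P i)"
      by (rule theI[of ?P, OF c]) (rule u[OF _ c])
    moreover have "quantizer K t = (THE i. ?P i)"
      using False t by (subst quantizer.simps) simp
    ultimately have "2 * real_of_int (quantizer K t) - 1 < t * 2"
      "t * 2 \<le> 2 * real_of_int (quantizer K t) + 1"
      by simp_all
    then show ?thesis
      by linarith
  qed
  show ?thesis
  proof (cases "r < - 1 / 2")
    case True
    then have "real_of_int (quantizer K r) = - real_of_int (quantizer K (- r))"
      by (subst quantizer.simps) simp
    then show ?thesis
      using pos[of "- r"] True assms(2) by linarith
  next
    case False
    then show ?thesis
      using assms by (intro pos) auto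
  qed
qed

section \<open>Exact error recursions along a run, before any step-size condition\<close>

locale quantized_run =
  fixes H :: "real^'m^'n" and z :: "real^'n" and E :: "('n::finite \<times> 'n) set"
    and h :: real and K :: int and \<gamma> s :: "nat \<Rightarrow> real" and ystar :: "real^'m"
    and x0 :: "'n \<Rightarrow> real^'m" and x b q :: "nat \<Rightarrow> 'n \<Rightarrow> real^'m"
    and xh :: "nat \<Rightarrow> 'n \<Rightarrow> 'n \<Rightarrow> real^'m"
  assumes run: "quantized_algorithm H z E h K \<gamma> s x0 x b q xh"
    and sym_E: "sym E" and z_eq: "z = H *v ystar"
    and \<gamma>_eq: "\<gamma> k = 1" and s_pos: "0 < s k"
begin

definition "w k = stack (x k) - kron_vec 1 ystar"

definition "e k = stack (x k) - stack (b k)"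

text \<open>Encoder and decoder obey the same recursion from the same initial value 0. Symmetry of
  \<open>E\<close> is used because the algorithm constrains \<open>xh k i j\<close> for
  \<open>i\<close> in \<open>neighbors E j\<close>.\<close>

lemma decoder_eq: "(i, j) \<in> E \<Longrightarrow> xh k i j = b k j"
proof (induction k)
  case 0
  then show ?case
    using run symD[OF sym_E] by (auto simp: quantized_algorithm_def neighbors_def)
next
  case (Suc k)
  have "xh (Suc k) i j = s k *\<^sub>R q (Suc k) j + xh k i j"
    using run symD[OF sym_E Suc.prems]
    by (fastforce simp: quantized_algorithm_def neighbors_def)
  moreover have "b (Suc k) j = s k *\<^sub>R q (Suc k) j + b k j"
    using run by (auto simp: quantized_algorithm_def)
  ultimately show ?case
    using Suc by simp
qed

lemma x_Suc_component:
  "x (Suc k) i $ a = x k i $ a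
    - h * ((\<Sum>j\<in>neighbors E i. b k i $ a - b k j $ a) + H $ i $ a * (H $ i \<bullet> (x k i - ystar)))"
proof -
  have "(\<Sum>j\<in>neighbors E i. xh k i j - b k i) = (\<Sum>j\<in>neighbors E i. b k j - b k i)"
    by (intro sum.cong) (auto simp: neighbors_def decoder_eq)
  then have "x (Suc k) i = x k i + h *\<^sub>R ((\<Sum>j\<in>neighbors E i. b k j - b k i)
        - (outer (H $ i) (H $ i) *v x k i - z $ i *\<^sub>R H $ i))"
    using run by (simp add: quantized_algorithm_def \<gamma>_eq)
  then have "x (Suc k) i $ a = x k i $ a + h * ((\<Sum>j\<in>neighbors E i. b k j $ a - b k i $ a)
        - ((outer (H $ i) (H $ i) *v x k i) $ a - z $ i * H $ i $ a))"
    by simp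
  moreover have "(outer (H $ i) (H $ i) *v x k i) $ a = H $ i $ a * (H $ i \<bullet> x k i)"
    by (simp add: matrix_vector_mult_def outer_def inner_vec_def sum_distrib_left mult.assoc)
  \<comment> \<open>Consistency of the equation turns the affine gradient term into a linear one in
    \<open>x k i - ystar\<close>.\<close>
  moreover have "z $ i = H $ i \<bullet> ystar"
    by (simp add: z_eq matrix_vector_mult_def inner_vec_def)
  ultimately show ?thesis
    by (simp add: sum_subtractf inner_diff_right algebra_simps)
qed

lemma Hd_w_component: "(Hd H *v w k) $ (i, a) = H $ i $ a * (H $ i \<bullet> (x k i - ystar))"
  by (simp add: Hd_def block_diag_mult_component w_def stack_def kron_vec_def)
    (simp add: matrix_vector_mult_def outer_def inner_vec_def sum_distrib_left mult.assoc)

lemma stack_x_Suc: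
  "stack (x (Suc k)) = stack (x k)
     - h *\<^sub>R (kron (laplacian E) (mat 1) *v stack (b k) + Hd H *v w k)"
  unfolding vec_eq_iff
  by (auto simp: Hd_w_component kron_mat_1_mult_component laplacian_mult_component)
    (auto simp: stack_def x_Suc_component)

text \<open>The encoder state is \<open>x\<close> minus \<open>e\<close>, and the Laplacian
  annihilates the consensus vector \<open>kron_vec 1 ystar\<close>, so \<open>x\<close> may be
  replaced by \<open>w\<close>.\<close>

lemma kron_laplacian_b:
  "kron (laplacian E) (mat 1) *v stack (b k) + Hd H *v w k
     = Fd H E *v w k - kron (laplacian E) (mat 1) *v e k"
proof -
  have "kron (laplacian E) (mat 1) *v stack (b k)
      = kron (laplacian E) (mat 1) *v w k - kron (laplacian E) (mat 1) *v e k"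
    unfolding vec_eq_iff
    by (auto simp: kron_mat_1_mult_component laplacian_mult_component w_def e_def stack_def
        kron_vec_def sum_subtractf algebra_simps)
  then show ?thesis
    by (simp add: Fd_def matrix_vector_mult_add_rdistrib)
qed

lemma w_Suc:
  "w (Suc k) = (w k - h *\<^sub>R (Fd H E *v w k)) + h *\<^sub>R (kron (laplacian E) (mat 1) *v e k)"
proof -
  have "w (Suc k) = w k + (stack (x (Suc k)) - stack (x k))"
    by (simp add: w_def)
  then show ?thesis
    by (simp add: stack_x_Suc kron_laplacian_b scaleR_diff_right)
qed

lemma quantizer_input:
  "stack (x (Suc k)) - stack (b k)
     = (e k + h *\<^sub>R (kron (laplacian E) (mat 1) *v e k)) - h *\<^sub>R (Fd H E *v w k)"
proof -
  have "stack (x (Suc k)) - stack (b k) = e k + (stack (x (Suc k)) - stack (x k))"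
    by (simp add: e_def)
  then show ?thesis
    by (simp add: stack_x_Suc kron_laplacian_b scaleR_diff_right)
qed

text \<open>The new encoder error is \<open>s k\<close> times the rounding error of the scaled
  quantizer input.\<close>

lemma infnorm_e_Suc_le:
  assumes "0 \<le> K" "infnorm (stack (x (Suc k)) - stack (b k)) \<le> s k * (real_of_int K + 1 / 2)"
  shows "infnorm (e (Suc k)) \<le> s k / 2"
proof (rule infnorm_le_cart)
  fix p :: "'n \<times> 'm"
  obtain i a where p: "p = (i, a)" by (cases p)
  define u where "u = (x (Suc k) i $ a - b k i $ a) / s k"
  have "\<bar>x (Suc k) i $ a - b k i $ a\<bar> \<le> s k * (real_of_int K + 1 / 2)"
    using component_le_infnorm_cart[of "stack (x (Suc k)) - stack (b k)" "(i, a)"] assms(2)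
    by (simp add: stack_def)
  then have "\<bar>u\<bar> \<le> real_of_int K + 1 / 2"
    using s_pos[of k] by (simp add: u_def abs_divide pos_divide_le_eq mult.commute)
  then have "\<bar>u - real_of_int (quantizer K u)\<bar> \<le> 1 / 2"
    by (rule quantizer_error[OF assms(1)])
  then have "s k * \<bar>u - real_of_int (quantizer K u)\<bar> \<le> s k * (1 / 2)"
    using s_pos[of k] by (intro mult_left_mono) auto
  moreover have "e (Suc k) $ p = s k * (u - real_of_int (quantizer K u))"
  proof -
    have "b (Suc k) i = s k *\<^sub>R q (Suc k) i + b k i"
      "q (Suc k) i = quantizer_vec K ((1 / s k) *\<^sub>R (x (Suc k) i - b k i))"
      using run by (auto simp: quantized_algorithm_def)
    then have "b (Suc k) i $ a = s k * quantizer K u + b k i $ a"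
      by (simp add: quantizer_vec_def u_def)
    then show ?thesis
      using s_pos[of k] by (simp add: p e_def stack_def u_def field_simps)
  qed
  ultimately show "\<bar>e (Suc k) $ p\<bar> \<le> s k / 2"
    using s_pos[of k] by (simp add: abs_mult)
qed

end

section \<open>Contraction, absence of saturation, and the limit\<close>

theorem theorem1:
  fixes H :: "real^'m^'n" and z :: "real^'n" and E :: "('n \<times> 'n) set"
    and ystar :: "real^'m" and x0 :: "'n \<Rightarrow> real^'m"
    and C\<^sub>x C\<^sub>w h \<alpha> :: real and K :: int and \<gamma> s :: "nat \<Rightarrow> real"
    and x b q :: "nat \<Rightarrow> 'n \<Rightarrow> real^'m" and xh :: "nat \<Rightarrow> 'n \<Rightarrow> 'n \<Rightarrow> real^'m"
  assumes "CARD('n) \<ge> 2"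
    and "connected_simple_graph E"
    and "rank H = CARD('m)" and "z \<in> span (columns H)" and "z = H *v ystar"
    and "C\<^sub>x > 0" and "\<forall>i. infnorm (x0 i) \<le> C\<^sub>x"
    and "C\<^sub>w > 0" and "\<forall>i. infnorm (x0 i - ystar) \<le> C\<^sub>w"
    and "\<forall>k. \<gamma> k = 1" and "s 0 > 0" and "\<alpha> \<in> {0<..<1}" and "\<forall>k. s k = s 0 * \<alpha> ^ k"
    and "h \<in> {0<..<2 / (lambda_min (Fd H E) + lambda_max (Fd H E))}"
    and "\<alpha> \<in> {1 - h * lambda_min (Fd H E)<..<1}"
    and "K \<ge> K_bound H E \<alpha> h"
    and "s 0 > max ((C\<^sub>x + h * onorm_inf (Hd H) * C\<^sub>w) / (K + 1/2))
                   (2 * (\<alpha> - rho H E h) * (rho H E h * C\<^sub>w + h * C\<^sub>x * lambda_max (laplacian E))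
                    / (h * lambda_max (laplacian E)))"
    and "quantized_algorithm H z E h K \<gamma> s x0 x b q xh"
  shows "(\<forall>i. (\<lambda>k. x k i) \<longlonglongrightarrow> ystar) \<and>
         limsup (\<lambda>k. ereal (norm (stack (x k) - kron_vec 1 ystar) / \<alpha> ^ k))
           \<le> ereal (h * s 0 * sqrt (real (CARD('m) * CARD('n))) * lambda_max (laplacian E)
                    / (2 * \<alpha> * (\<alpha> - rho H E h)))"
proof -
  have sym_E: "sym E"
    using assms(2) by (simp add: connected_simple_graph_def)
  have \<alpha>: "0 < \<alpha>" "\<alpha> < 1"
    using assms(12) by auto
  have s_eq: "s k = s 0 * \<alpha> ^ k" for k
    using assms(13) by blast
  have s_pos: "0 < s k" for k
    by (subst s_eq) (use assms(11) \<alpha> in simp)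
  interpret quantized_run H z E h K \<gamma> s ystar x0 x b q xh
    by (rule quantized_run.intro[OF assms(18) sym_E assms(5) assms(10)[rule_format] s_pos])
  define \<rho> where "\<rho> = rho H E h"
  define \<Lambda> where "\<Lambda> = lambda_max (laplacian E)"
  define F where "F = lambda_max (Fd H E)"
  define r where "r = sqrt (real (CARD('m) * CARD('n)))"
  define c where "c = h * r * \<Lambda> / (2 * (\<alpha> - \<rho>))"
  note sym_F = transpose_Fd[OF sym_E, of H]
  have \<Lambda>: "0 < \<Lambda>"
    unfolding \<Lambda>_def by (rule lambda_max_laplacian_pos[OF assms(2,1)])
  have r: "0 < r"
    by (simp add: r_def)
  have h: "0 < h" "h < 2 / (lambda_min (Fd H E) + F)"
    using assms(14) by (auto simp: F_def)
  \<comment> \<open>Positivity is read off from the step size: a positive \<open>h\<close> lies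
    below the quotient, so its denominator is positive.\<close>
  have sum_pos: "0 < lambda_min (Fd H E) + F"
    using h by (metis less_trans zero_less_divide_iff zero_less_numeral not_less_iff_gr_or_eq)
  have hF: "h * (lambda_min (Fd H E) + F) < 2"
    using h(2) sum_pos by (simp add: pos_less_divide_eq)
  have \<rho>: "0 \<le> \<rho>" "\<rho> < \<alpha>"
  proof -
    \<comment> \<open>Hence twice \<open>h * lambda_min (Fd H E)\<close> is at most
      \<open>h * (lambda_min (Fd H E) + F)\<close>, which is below 2.\<close>
    have "h * lambda_min (Fd H E) \<le> h * F"
      unfolding F_def using lambda_min_le_lambda_max[OF sym_F] h by (intro mult_left_mono) auto
    then show "0 \<le> \<rho>"
      using hF by (simp add: \<rho>_def rho_def algebra_simps)
    show "\<rho> < \<alpha>"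
      using assms(15) by (simp add: \<rho>_def rho_def)
  qed
  have F: "0 \<le> F"
    unfolding F_def using lambda_min_le_lambda_max[OF sym_F] sum_pos F_def by linarith
  have c: "0 < c"
    unfolding c_def using h r \<Lambda> \<rho> by (intro divide_pos_pos mult_pos_pos) auto
  have s_Suc: "s (Suc k) = \<alpha> * s k" for k
    by (simp add: s_eq[of k] s_eq[of "Suc k"])

  have norm_stack_le: "norm v \<le> r * infnorm v" for v :: "real^('n \<times> 'm)"
    using norm_le_infnorm_cart[of v] by (simp add: r_def mult.commute)
  have norm_w_Suc_le: "norm (w (Suc k)) \<le> \<rho> * norm (w k) + h * \<Lambda> * norm (e k)" for k
  proof -
    have "norm (w k - h *\<^sub>R (Fd H E *v w k)) \<le> \<rho> * norm (w k)"
      unfolding \<rho>_def rho_def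
      by (rule norm_diff_symmetric_matrix_le[OF sym_F]) (use h hF in \<open>auto simp: F_def\<close>)
    moreover have "norm (h *\<^sub>R (kron (laplacian E) (mat 1) *v e k)) \<le> h * (\<Lambda> * norm (e k))"
      using norm_kron_laplacian_le[OF sym_E, of "e k"] h by (simp add: \<Lambda>_def)
    ultimately show ?thesis
      unfolding w_Suc using norm_triangle_ineq[of "w k - h *\<^sub>R (Fd H E *v w k)"
        "h *\<^sub>R (kron (laplacian E) (mat 1) *v e k)"] by linarith
  qed

  have K_M: "M_bound H E \<alpha> h \<le> real_of_int K + 1 / 2"
    using assms(16) by (simp add: K_bound_def ceiling_le_iff)
  \<comment> \<open>The two summands match the contributions of \<open>e\<close> and
    \<open>w\<close> to the quantizer input; dividing by \<open>\<alpha>\<close> measures them in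
    units of \<open>s (Suc k)\<close> instead of \<open>s k\<close>.\<close>
  have M_eq: "M_bound H E \<alpha> h = (1 + 2 * h * real (max_degree E)) / (2 * \<alpha>) + h * F * c / \<alpha>"
    using \<alpha> \<rho> by (simp add: M_bound_def c_def r_def F_def \<Lambda>_def \<rho>_def field_simps power2_eq_square)
  have "0 < M_bound H E \<alpha> h"
    unfolding M_eq using \<alpha> h F c
    by (intro add_pos_nonneg divide_pos_pos) (auto intro: add_pos_nonneg)
  \<comment> \<open>Integrality of \<open>K\<close> upgrades \<open>K > - 1/2\<close> to
    \<open>0 \<le> K\<close>.\<close>
  then have K: "0 < real_of_int K + 1 / 2" "0 \<le> K"
    using K_M by linarith+

  have x_0: "infnorm (stack (x 0)) \<le> C\<^sub>x"
  proof (rule infnorm_le_cart)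
    fix p :: "'n \<times> 'm"
    have "x 0 = x0"
      using run by (auto simp: quantized_algorithm_def)
    then show "\<bar>stack (x 0) $ p\<bar> \<le> C\<^sub>x"
      using component_le_infnorm_cart[of "x0 (fst p)" "snd p"] assms(7) order_trans
      by (fastforce simp: stack_def)
  qed
  have w_0: "infnorm (w 0) \<le> C\<^sub>w"
  proof (rule infnorm_le_cart)
    fix p :: "'n \<times> 'm"
    have "x 0 = x0"
      using run by (auto simp: quantized_algorithm_def)
    then show "\<bar>w 0 $ p\<bar> \<le> C\<^sub>w"
      using component_le_infnorm_cart[of "x0 (fst p) - ystar" "snd p"] assms(9) order_trans
      by (fastforce simp: w_def stack_def kron_vec_def)
  qed
  have b_0: "stack (b 0) = 0"
    using run by (simp add: quantized_algorithm_def stack_def vec_eq_iff)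
  have e_0: "infnorm (e 0) \<le> C\<^sub>x"
    using x_0 by (simp add: e_def b_0)
  \<comment> \<open>The first bound keeps the first quantizer input in range; the second starts the
    estimate of \<open>w\<close>.\<close>
  have s_0: "C\<^sub>x + h * onorm_inf (Hd H) * C\<^sub>w < s 0 * (real_of_int K + 1 / 2)"
    "\<rho> * C\<^sub>w + h * C\<^sub>x * \<Lambda> < s 0 * (h * \<Lambda>) / (2 * (\<alpha> - \<rho>))"
    using assms(17) K(1) h \<Lambda> \<rho>
    by (auto simp: pos_divide_less_eq pos_less_divide_eq \<Lambda>_def \<rho>_def mult_ac)

  \<comment> \<open>The estimates start at index 1: nothing has been quantized at time 0, where
    \<open>e 0\<close> is the whole initial state and is controlled by \<open>C\<^sub>x\<close>
    instead.\<close>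
  have main: "norm (w (Suc k)) \<le> c * s k \<and> infnorm (e (Suc k)) \<le> s k / 2" for k
  proof (induction k)
    case 0
    have "norm (w (Suc 0)) \<le> \<rho> * (r * C\<^sub>w) + h * \<Lambda> * (r * C\<^sub>x)"
    proof -
      have "norm (w 0) \<le> r * C\<^sub>w" "norm (e 0) \<le> r * C\<^sub>x"
        using norm_stack_le w_0 e_0 r by (meson mult_left_mono order_trans less_imp_le)+
      then have "\<rho> * norm (w 0) \<le> \<rho> * (r * C\<^sub>w)" "h * \<Lambda> * norm (e 0) \<le> h * \<Lambda> * (r * C\<^sub>x)"
        using \<rho> h \<Lambda> by (auto intro: mult_left_mono)
      then show ?thesis
        using norm_w_Suc_le[of 0] by linarith
    qed
    also have "\<dots> = r * (\<rho> * C\<^sub>w + h * C\<^sub>x * \<Lambda>)"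
      by (simp add: algebra_simps)
    also have "\<dots> \<le> r * (s 0 * (h * \<Lambda>) / (2 * (\<alpha> - \<rho>)))"
      using s_0(2) r by (intro mult_left_mono) auto
    also have "\<dots> = c * s 0"
      by (simp add: c_def)
    finally have w: "norm (w (Suc 0)) \<le> c * s 0" .
    \<comment> \<open>Since \<open>b 0\<close> vanishes, the Laplacian term drops out of the first
      update; this is why only \<open>Hd H\<close> enters the first bound on
      \<open>s 0\<close>.\<close>
    have x1: "stack (x (Suc 0)) - stack (b 0) = stack (x 0) - h *\<^sub>R (Hd H *v w 0)"
      by (simp add: stack_x_Suc b_0)
    have "infnorm (Hd H *v w 0) \<le> onorm_inf (Hd H) * infnorm (w 0)"
      by (rule infnorm_mult_le_onorm_inf)
    also have "\<dots> \<le> onorm_inf (Hd H) * C\<^sub>w"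
      using w_0 by (intro mult_left_mono onorm_inf_nonneg) auto
    finally have "h * infnorm (Hd H *v w 0) \<le> h * (onorm_inf (Hd H) * C\<^sub>w)"
      using h by (intro mult_left_mono) auto
    then have "infnorm (stack (x (Suc 0)) - stack (b 0)) \<le> s 0 * (real_of_int K + 1 / 2)"
      unfolding x1 using infnorm_diff_scaleR_le[of h "stack (x 0)" "Hd H *v w 0"] x_0 s_0(1) h
      by (simp only: mult.assoc) linarith
    then show ?case
      using w infnorm_e_Suc_le[OF K(2)] by blast
  next
    case (Suc k)
    have "norm (e (Suc k)) \<le> r * (s k / 2)"
      using norm_stack_le Suc r by (meson mult_left_mono order_trans less_imp_le)
    then have "\<rho> * norm (w (Suc k)) + h * \<Lambda> * norm (e (Suc k))
        \<le> \<rho> * (c * s k) + h * \<Lambda> * (r * (s k / 2))"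
      using Suc \<rho> h \<Lambda> by (intro add_mono mult_left_mono) auto
    \<comment> \<open>This is the fixed-point equation of \<open>c\<close>: the quantization noise
      makes up exactly what contraction by \<open>\<rho>\<close> removes beyond the factor
      \<open>\<alpha>\<close>.\<close>
    also have "h * \<Lambda> * (r * (s k / 2)) = (\<alpha> - \<rho>) * c * s k"
    proof -
      have "c * (2 * (\<alpha> - \<rho>)) = h * r * \<Lambda>"
        unfolding c_def by (rule nonzero_eq_divide_eq[THEN iffD1, OF _ refl]) (use \<rho> in simp)
      then show ?thesis
        by algebra
    qed
    also have "\<rho> * (c * s k) + (\<alpha> - \<rho>) * c * s k = c * s (Suc k)"
      by (simp add: s_Suc algebra_simps)
    finally have w: "norm (w (Suc (Suc k))) \<le> c * s (Suc k)"
      using norm_w_Suc_le order_trans by blast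

    let ?d = "1 + 2 * h * real (max_degree E)"
    have "norm (Fd H E *v w (Suc k)) \<le> F * norm (w (Suc k))"
      unfolding F_def using sum_pos
      by (intro norm_symmetric_matrix_le[OF sym_F]) (auto simp: F_def)
    also have "\<dots> \<le> F * (c * s k)"
      using Suc F by (intro mult_left_mono) auto
    finally have "infnorm (Fd H E *v w (Suc k)) \<le> F * (c * s k)"
      using infnorm_le_norm order_trans by blast
    then have 1: "h * infnorm (Fd H E *v w (Suc k)) \<le> h * (F * (c * s k))"
      using h by (intro mult_left_mono) auto
    have 2: "infnorm (e (Suc k) + h *\<^sub>R (kron (laplacian E) (mat 1) *v e (Suc k))) \<le> ?d * (s k / 2)"
      using infnorm_add_kron_laplacian_le[of h "e (Suc k)" E] h Suc
      by (meson add_nonneg_nonneg less_imp_le mult_left_mono mult_nonneg_nonneg of_nat_0_le_iff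
          order_trans zero_le_numeral zero_le_one)
    have "infnorm (stack (x (Suc (Suc k))) - stack (b (Suc k)))
        \<le> infnorm (e (Suc k) + h *\<^sub>R (kron (laplacian E) (mat 1) *v e (Suc k)))
          + h * infnorm (Fd H E *v w (Suc k))"
      unfolding quantizer_input using h by (intro infnorm_diff_scaleR_le) auto
    also have "\<dots> \<le> ?d * (s k / 2) + h * (F * (c * s k))"
      using 1 2 by linarith
    also have "\<dots> = s (Suc k) * M_bound H E \<alpha> h"
      using \<alpha> by (simp add: M_eq s_Suc field_simps)
    also have "\<dots> \<le> s (Suc k) * (real_of_int K + 1 / 2)"
      using K_M s_pos[of "Suc k"] by (intro mult_left_mono) auto
    finally show ?case
      using w infnorm_e_Suc_le[OF K(2)] by blast
  qed

  \<comment> \<open>The bound on \<open>w (Suc k)\<close> carries \<open>\<alpha> ^ k\<close>;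
    passing to \<open>\<alpha> ^ Suc k\<close> puts the extra \<open>\<alpha>\<close> in the
    denominator of the final constant.\<close>
  define B where "B = c * s 0 / \<alpha>"
  have w_le: "norm (w (Suc k)) \<le> B * \<alpha> ^ Suc k" for k
    using main[of k] \<alpha> by (simp add: B_def s_eq[of k] mult_ac)
  have ev: "\<forall>\<^sub>F k in sequentially. norm (w k) \<le> B * \<alpha> ^ k"
    by (rule eventually_sequentiallyI[of 1]) (metis w_le Suc_le_D One_nat_def)
  have "(\<lambda>k. B * \<alpha> ^ k) \<longlonglongrightarrow> 0"
    using \<alpha> by (intro tendsto_mult_right_zero LIMSEQ_power_zero) auto
  with ev have w_lim: "w \<longlonglongrightarrow> 0"
    by (rule Lim_null_comparison)
  have "(\<lambda>k. x k i) \<longlonglongrightarrow> ystar" for i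
  proof (rule vec_tendstoI)
    fix a
    have "(\<lambda>k. w k $ (i, a) + ystar $ a) \<longlonglongrightarrow> 0 + ystar $ a"
      using tendsto_vec_nth[OF w_lim, of "(i, a)"] by (intro tendsto_add) auto
    then show "(\<lambda>k. x k i $ a) \<longlonglongrightarrow> ystar $ a"
      by (simp add: w_def stack_def kron_vec_def)
  qed
  moreover have "limsup (\<lambda>k. ereal (norm (w k) / \<alpha> ^ k)) \<le> ereal B"
    using ev \<alpha> by (intro Limsup_bounded) (auto elim!: eventually_mono simp: pos_divide_le_eq)
  moreover have "B = h * s 0 * r * \<Lambda> / (2 * \<alpha> * (\<alpha> - \<rho>))"
    by (simp add: B_def c_def algebra_simps)
  ultimately show ?thesis
    by (simp add: w_def r_def \<Lambda>_def \<rho>_def)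
qed

end
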